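(* Let $q$ be a prime power, and let $k,d \in \mathbb{N}$ be such that $\gcd(d+1, q^k-1) = 1$. Set $n = \sum_{r=0}^{d} q^{kr} = \frac{q^{k(d+1)}-1}{q^k-1}$. Then $h_q(n) = kd$.
   Context: For a prime power $q$ and $n \in \mathbb{N}$, let $\sigma:\mathbb{F}_q^n\to\mathbb{F}_q^n$ be the cyclic shift $\sigma(\sum_{i=1}^n x_i e_i)=\sum_{i=1}^n x_{i-1}e_i$ (indices mod $n$), where $e_1,\dots,e_n$ is the standard basis. A subspace $U\le \mathbb{F}_q^n$ is cyclically covering if $\bigcup_{r=0}^{n-1}\sigma^r(U)=\mathbb{F}_q^n$. $h_q(n)$ denotes the maximum possible codimension of a cyclically covering subspace of $\mathbb{F}_q^n$. *)

theory Defs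
  imports "Jordan_Normal_Form.VS_Connect" "HOL-Number_Theory.Prime_Powers"
begin

text \<open>The space \<open>\<F>\<^sub>q\<^sup>n\<close> is \<open>module_vec TYPE('a) n\<close>, where \<open>'a\<close> is a finite field with \<open>q\<close> elements.\<close>

text \<open>Coordinates are indexed by \<open>0, \<dots>, n - 1\<close>; the summand \<open>dim_vec x\<close> keeps the natural-number
  subtraction from truncating at \<open>i = 0\<close>.\<close>

definition cyclic_shift :: "'a vec \<Rightarrow> 'a vec" where
  "cyclic_shift x = vec (dim_vec x) (\<lambda>i. x $ ((i + dim_vec x - 1) mod dim_vec x))"

definition cyclically_covering :: "nat \<Rightarrow> 'a::field vec set \<Rightarrow> bool" where
  "cyclically_covering n U \<longleftrightarrow>
     VectorSpace.subspace class_ring U (module_vec TYPE('a) n) \<and>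
     (\<Union>r\<in>{0..<n}. (cyclic_shift ^^ r) ` U) = carrier_vec n"

definition codimension :: "nat \<Rightarrow> 'a::field vec set \<Rightarrow> nat" where
  "codimension n U =
     vectorspace.dim class_ring (module_vec TYPE('a) n) -
     vectorspace.dim class_ring ((module_vec TYPE('a) n)\<lparr>carrier := U\<rparr>)"

text \<open>For \<open>n \<ge> 1\<close> the maximum is over a nonempty set, as the whole space is cyclically covering.\<close>

definition max_covering_codim :: "'a::field itself \<Rightarrow> nat \<Rightarrow> nat" where
  "max_covering_codim ty n = Max {codimension n U | U :: 'a vec set. cyclically_covering n U}"

lemma sum_powers_eq_quotient:
  fixes q k d :: nat
  assumes "q \<ge> 2" and "k \<ge> 1"
  shows "real (\<Sum>r=0..d. q ^ (k * r)) = (real q ^ (k * (d + 1)) - 1) / (real q ^ k - 1)"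
proof -
  have "1 < q ^ k"
    using assms by (intro one_less_power) auto
  then have "real q ^ k \<noteq> 1"
    by (metis of_nat_1 of_nat_eq_iff of_nat_power less_irrefl)
  then have "(\<Sum>r<Suc d. (real q ^ k) ^ r) = ((real q ^ k) ^ Suc d - 1) / (real q ^ k - 1)"
    by (rule geometric_sum)
  then show ?thesis
    by (simp add: power_mult lessThan_Suc_atMost atMost_atLeast0 flip: power_mult power_add)
qed

end

theory Submission
  imports Defs "HOL-Algebra.Algebraic_Closure_Type" "HOL-Algebra.Multiplicative_Group"
    "HOL-Number_Theory.Residues"
begin

text \<open>
  Upper bound: the \<open>n\<close> shifts of a covering subspace \<open>U\<close> of codimension \<open>c\<close> have to contain all
  \<open>q\<^sup>n\<close> vectors, so \<open>q\<^sup>c \<le> n < 2 q\<^bsup>kd\<^esup>\<close>.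

  Lower bound: let \<open>K \<subseteq> L\<close> be the fields with \<open>q\<^sup>k\<close> and \<open>q\<^bsup>k(d+1)\<^esup>\<close> elements inside an algebraic
  closure. As \<open>n \<equiv> d + 1\<close> modulo \<open>q\<^sup>k - 1\<close>, the orders \<open>n\<close> and \<open>q\<^sup>k - 1\<close> are coprime and their
  product is the order of the cyclic group \<open>L\<^sup>*\<close>; hence \<open>L\<^sup>*\<close> is the direct product of \<open>K\<^sup>*\<close> and
  the group generated by an element \<open>\<beta>\<close> of order \<open>n\<close>. Under the evaluation
  \<open>x \<mapsto> \<Sum> x\<^sub>i \<beta>\<^sup>i \<in> L\<close> the shift becomes multiplication by \<open>\<beta>\<close>, so the preimage \<open>U\<close> of \<open>K\<close> is
  cyclically covering. The shifts of \<open>U\<close> meet only in the kernel \<open>W\<close> of the evaluation, and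
  \<open>card W \<le> card U / 2\<close>, which yields \<open>n \<le> 2 q\<^sup>c\<close> for the codimension \<open>c\<close> of \<open>U\<close>; since
  \<open>n > q\<^bsup>kd\<^esup>\<close> for \<open>d > 0\<close>, this forces \<open>c \<ge> kd\<close>.
\<close>

(* Otherwise "$" is ambiguous between vectors and formal power series. *)
no_notation fps_nth (infixl "$" 75)

section \<open>Finite fields inside the algebraic closure\<close>

text \<open>Multiplication by a nonzero \<open>x\<close> permutes the nonzero elements; comparing
  their products before and after gives \<open>x ^ card ?S = 1\<close>.\<close>

lemma power_card_UNIV_eq_self:
  fixes x :: "'a::{field,finite}"
  shows "x ^ card (UNIV :: 'a set) = x"
proof (cases "x = 0")
  case True
  then show ?thesis by (simp add: power_0_left)
next
  case False
  let ?S = "UNIV - {0 :: 'a}"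
  have "bij_betw ((*) x) ?S ?S"
    using False by (intro bij_betwI[where g = "\<lambda>y. y / x"]) auto
  then have "(\<Prod>y\<in>?S. x * y) = \<Prod>?S"
    by (rule prod.reindex_bij_betw)
  moreover have "(\<Prod>y\<in>?S. x * y) = x ^ card ?S * \<Prod>?S"
    by (simp add: prod.distrib)
  moreover have "\<Prod>?S \<noteq> 0"
    by simp
  ultimately have "x ^ card ?S = 1"
    by simp
  moreover have "card (UNIV :: 'a set) = Suc (card ?S)"
    using card_Suc_Diff1[of UNIV "0 :: 'a"] by (simp only: finite UNIV_I)
  ultimately show ?thesis
    by (simp only: power_Suc mult_1_right)
qed

text \<open>The fixed points are the roots of X^m - X. This polynomial splits, and its derivative is
  -1 because \<open>m\<close> vanishes in the field, so its \<open>m\<close> roots are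
  distinct.\<close>

lemma card_fixed_points_power:
  fixes m :: nat
  assumes "m \<ge> 2" and "(of_nat m :: 'a::alg_closed_field) = 0"
  shows "card {x :: 'a. x ^ m = x} = m"
proof -
  define p :: "'a poly" where "p = Polynomial.monom 1 m - Polynomial.monom 1 1"
  have [simp]: "poly p x = x ^ m - x" for x
    by (simp add: p_def poly_monom)
  have deg: "Polynomial.degree p = m"
    unfolding p_def diff_conv_add_uminus using assms(1)
    by (subst degree_add_eq_left) (auto simp: degree_monom_eq)
  then have "p \<noteq> 0" using assms(1) by auto
  have lead: "Polynomial.lead_coeff p = 1"
    using assms(1) by (simp add: deg) (simp add: p_def)
  obtain A where A: "size A = m" "p = (\<Prod>x\<in>#A. [:-x, 1:])"
    using alg_closed_imp_factorization[OF \<open>p \<noteq> 0\<close>] deg lead by auto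
  have "pderiv p = - 1"
    using assms by (simp add: p_def pderiv_diff pderiv_monom monom_0 one_pCons)
  have le: "count A x \<le> 1" for x
  proof (rule ccontr)
    assume "\<not> count A x \<le> 1"
    then have "{#x, x#} \<subseteq># A"
      by (auto simp: subseteq_mset_def)
    then obtain B where "A = {#x, x#} + B"
      by (metis mset_subset_eq_exists_conv)
    then have "p = [:-x, 1:] * ([:-x, 1:] * (\<Prod>x\<in>#B. [:-x, 1:]))"
      using A(2) by simp
    then have "poly (pderiv p) x = 0"
      by (simp only: pderiv_mult) simp
    then show False
      using \<open>pderiv p = - 1\<close> by simp
  qed
  have "size A = card (set_mset A)"
  proof -
    have "count A x = 1" if "x \<in># A" for x
      using that le[of x] by (simp add: le_antisym Suc_leI)
    then show ?thesis
      by (simp add: size_multiset_overloaded_eq)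
  qed
  moreover have "{x. x ^ m = x} = set_mset A"
  proof -
    have "poly p x = 0 \<longleftrightarrow> x \<in> set_mset A" for x
      unfolding A(2) by (auto simp: poly_prod_mset prod_mset_zero_iff)
    then show ?thesis by auto
  qed
  ultimately show ?thesis
    using A(1) by simp
qed

lemma finite_subfield_has_generator:
  fixes L :: "'a::field set"
  assumes fin: "finite L" and L: "0 \<in> L" "1 \<in> L"
    and add: "\<And>x y. x \<in> L \<Longrightarrow> y \<in> L \<Longrightarrow> x + y \<in> L"
    and minus: "\<And>x. x \<in> L \<Longrightarrow> - x \<in> L"
    and mult: "\<And>x y. x \<in> L \<Longrightarrow> y \<in> L \<Longrightarrow> x * y \<in> L"
    and inv: "\<And>x. x \<in> L \<Longrightarrow> inverse x \<in> L"
  shows "\<exists>g. g \<noteq> 0 \<and> L - {0} = range (\<lambda>i. g ^ i) \<and> (\<forall>i. g ^ i = 1 \<longleftrightarrow> (card L - 1) dvd i)"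
proof -
  \<comment> \<open>Packaging \<open>L\<close> as a ring record makes the cyclicity of the
    multiplicative group of a finite field applicable to a subset of a type.\<close>
  define R :: "'a ring" where "R = \<lparr>carrier = L, monoid.mult = (*), one = 1, ring.zero = 0, ring.add = (+)\<rparr>"
  have "abelian_group R"
  proof (rule abelian_groupI)
    fix x assume "x \<in> carrier R"
    then show "\<exists>y\<in>carrier R. y \<oplus>\<^bsub>R\<^esub> x = \<zero>\<^bsub>R\<^esub>"
      by (intro bexI[of _ "- x"]) (simp_all add: R_def minus)
  qed (use L in \<open>simp_all add: R_def add add.assoc add.commute\<close>)
  moreover have "comm_monoid R"
    by (rule comm_monoidI) (use L in \<open>simp_all add: R_def mult\<close>)
  ultimately have "cring R"
    by (rule cringI) (simp add: R_def distrib_right)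
  then have "field R"
  proof (rule cring.cring_fieldI2)
    fix x assume "x \<in> carrier R" "x \<noteq> \<zero>\<^bsub>R\<^esub>"
    then show "\<exists>y\<in>carrier R. x \<otimes>\<^bsub>R\<^esub> y = \<one>\<^bsub>R\<^esub>"
      by (intro bexI[of _ "inverse x"]) (simp_all add: R_def inv)
  qed (simp add: R_def)
  have pow: "x [^]\<^bsub>R\<^esub> i = x ^ i" for x and i :: nat
    by (induction i) (simp_all add: R_def nat_pow_def)
  have "\<exists>g\<in>L - {0}. L - {0} = {g ^ i | i. i \<in> UNIV}"
    using field.finite_field_mult_group_has_gen[OF \<open>field R\<close>] fin
    unfolding carrier_mult_of nat_pow_mult_of pow by (simp add: R_def)
  moreover have "{g ^ i | i :: nat. i \<in> UNIV} = range (\<lambda>i. g ^ i)" for g :: 'a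
    by auto
  ultimately have "\<exists>g\<in>L - {0}. L - {0} = range (\<lambda>i. g ^ i)"
    by simp
  then obtain g where g: "g \<in> L - {0}" "L - {0} = range (\<lambda>i. g ^ i)"
    by blast
  define N where "N = card L - 1"
  have cardL: "card (L - {0}) = N"
    using L fin by (simp add: N_def)
  have "N > 0"
    using cardL fin L by (metis DiffI card_gt_0_iff empty_iff finite_Diff one_neq_zero singletonD)
  have "bij_betw ((*) g) (L - {0}) (L - {0})"
    using g(1) inv mult
    by (intro bij_betwI[where g = "\<lambda>y. inverse g * y"]) auto
  then have "(\<Prod>y\<in>L - {0}. g * y) = \<Prod>(L - {0})"
    by (rule prod.reindex_bij_betw)
  moreover have "(\<Prod>y\<in>L - {0}. g * y) = g ^ N * \<Prod>(L - {0})"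
    by (simp add: prod.distrib cardL)
  ultimately have gN: "g ^ N = 1"
    using fin by simp
  have mod: "g ^ i = g ^ (i mod N)" for i
  proof -
    have "g ^ i = g ^ (N * (i div N) + i mod N)" by simp
    also have "\<dots> = g ^ (i mod N)"
      unfolding power_add power_mult gN by simp
    finally show ?thesis .
  qed
  have "L - {0} = (\<lambda>i. g ^ i) ` {..<N}"
    unfolding g(2)
  proof safe
    fix i show "g ^ i \<in> (\<lambda>i. g ^ i) ` {..<N}"
      using mod[of i] \<open>N > 0\<close> by auto
  qed auto
  \<comment> \<open>The \<open>N\<close> exponents below \<open>N\<close> already produce all
    \<open>N\<close> nonzero elements, so no two of these powers coincide and the order of
    \<open>g\<close> is exactly \<open>N\<close>.\<close>
  then have inj: "inj_on (\<lambda>i. g ^ i) {..<N}"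
    by (intro eq_card_imp_inj_on) (simp_all flip: cardL)
  have "g ^ i = 1 \<longleftrightarrow> N dvd i" for i
  proof
    assume "g ^ i = 1"
    then have "g ^ (i mod N) = g ^ 0" using mod[of i] by simp
    then have "i mod N = 0"
      using inj_onD[OF inj, of "i mod N" 0] \<open>N > 0\<close> by simp
    then show "N dvd i" by auto
  next
    assume "N dvd i"
    then show "g ^ i = 1" using gN by (auto simp: power_mult)
  qed
  then show ?thesis
    using g unfolding N_def by blast
qed

section \<open>Arithmetic of the number n\<close>

lemma sum_powers_mult_diff:
  fixes a :: nat
  assumes "a \<ge> 1"
  shows "(\<Sum>r=0..d. a ^ r) * (a - 1) = a ^ (d + 1) - 1"
proof -
  obtain b where a: "a = Suc b" using assms by (cases a) auto
  have "(\<Sum>r=0..d. a ^ r) * b + 1 = a ^ (d + 1)"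
    by (induction d) (simp_all add: a algebra_simps)
  then show ?thesis by (simp add: a)
qed

text \<open>Every power of \<open>a\<close> is 1 modulo \<open>a - 1\<close>, so the sum is
  congruent to its number of terms, \<open>d + 1\<close>.\<close>

lemma coprime_sum_powers:
  fixes a :: nat
  assumes "a \<ge> 1" and "coprime (d + 1) (a - 1)"
  shows "coprime (\<Sum>r=0..d. a ^ r) (a - 1)"
proof -
  have "[a = 1] (mod (a - 1))"
    using assms(1) by (metis cong_add_rcancel_0_nat cong_refl cong_def le_add_diff_inverse2 mod_add_self1)
  then have "[(\<Sum>r=0..d. a ^ r) = (\<Sum>r=0..d. 1 ^ r)] (mod (a - 1))"
    by (intro cong_sum cong_pow)
  then have "[d + 1 = (\<Sum>r=0..d. a ^ r)] (mod (a - 1))"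
    by (simp add: cong_sym)
  then show ?thesis
    using assms(2) by (rule cong_imp_coprime)
qed

text \<open>The characteristic divides the cardinality, so it is the prime underlying it. This form
  is what the additivity of Frobenius powers requires.\<close>

lemma CARD_eq_CHAR_power:
  assumes "primepow (card (UNIV :: 'a::{field,finite} set))"
  obtains m where "card (UNIV :: 'a set) = CHAR('a) ^ m" "m > 0" "Factorial_Ring.prime CHAR('a)"
proof -
  have p: "Factorial_Ring.prime CHAR('a)"
    by (intro prime_CHAR_semidom finite_imp_CHAR_pos) simp
  from assms obtain p m where pm: "Factorial_Ring.prime p" "m > 0" "card (UNIV :: 'a set) = p ^ m"
    by (auto simp: primepow_def)
  have "CHAR('a) dvd p ^ m"
    using CHAR_dvd_CARD[where ?'a = 'a] pm(3) by simp
  then have "CHAR('a) = p"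
    using p pm(1) by (metis prime_dvd_power primes_dvd_imp_eq)
  with that p pm show thesis by blast
qed

section \<open>Frobenius powers and their fixed fields in the algebraic closure\<close>

context
  fixes q :: nat
  assumes q: "q = card (UNIV :: 'a::{field,finite} set)" and pp: "primepow q"
begin

lemma frobenius_sum:
  fixes f :: "'b \<Rightarrow> 'a alg_closure"
  shows "(\<Sum>i\<in>A. f i) ^ (q ^ e) = (\<Sum>i\<in>A. f i ^ (q ^ e))"
proof -
  obtain m where m: "q = CHAR('a) ^ m" "Factorial_Ring.prime CHAR('a)"
    using CARD_eq_CHAR_power pp unfolding q by metis
  show ?thesis
    by (rule freshmans_dream_sum'[of _ "m * e"]) (simp_all add: m power_mult)
qed

lemma frobenius_add:
  fixes x y :: "'a alg_closure"
  shows "(x + y) ^ (q ^ e) = x ^ (q ^ e) + y ^ (q ^ e)"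
proof -
  obtain m where m: "q = CHAR('a) ^ m" "Factorial_Ring.prime CHAR('a)"
    using CARD_eq_CHAR_power pp unfolding q by metis
  show ?thesis
    by (rule freshmans_dream'[of _ "m * e"]) (simp_all add: m power_mult)
qed

text \<open>Additivity applied to \<open>x + (- x) = 0\<close> avoids a case distinction on the
  parity of \<open>q\<close>.\<close>

lemma frobenius_minus:
  fixes x :: "'a alg_closure"
  shows "(- x) ^ (q ^ e) = - (x ^ (q ^ e))"
proof -
  have "q > 0" using pp primepow_gt_0_nat by blast
  then have "x ^ (q ^ e) + (- x) ^ (q ^ e) = 0"
    using frobenius_add[of x "- x" e] by (simp add: power_0_left)
  then show ?thesis
    by (simp add: add_eq_0_iff)
qed

lemma frobenius_to_ac: "to_ac (c :: 'a) ^ (q ^ e) = to_ac c"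
proof -
  have "c ^ (q ^ e) = c"
    by (induction e) (simp_all add: power_mult power_card_UNIV_eq_self q)
  then show ?thesis by (simp flip: to_ac_power)
qed

text \<open>By additivity and multiplicativity of Frobenius, its fixed points form a subfield, and
  it has \<open>q ^ e\<close> elements since \<open>q ^ e\<close> is zero in characteristic dividing
  \<open>q\<close>.\<close>

lemma fixed_field_generator:
  assumes "e > 0"
  obtains g :: "'a alg_closure" where
    "g \<noteq> 0"
    "\<And>y. y ^ (q ^ e) = y \<Longrightarrow> y \<noteq> 0 \<Longrightarrow> \<exists>i. y = g ^ i"
    "\<And>i. g ^ i = 1 \<longleftrightarrow> (q ^ e - 1) dvd i"
proof -
  let ?L = "{x :: 'a alg_closure. x ^ (q ^ e) = x}"
  obtain m where m: "q = CHAR('a) ^ m" "m > 0" "Factorial_Ring.prime CHAR('a)"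
    using CARD_eq_CHAR_power pp unfolding q by metis
  have "q \<ge> 2" using pp primepow_gt_Suc_0 by fastforce
  then have "q ^ e \<ge> 2"
    using assms by (metis le_trans self_le_power one_le_numeral order_trans)
  moreover have "(of_nat (q ^ e) :: 'a alg_closure) = 0"
    using m assms by (simp add: of_nat_eq_0_iff_char_dvd dvd_power flip: power_mult)
  ultimately have card: "card ?L = q ^ e"
    by (rule card_fixed_points_power)
  have "finite ?L"
    by (rule card_ge_0_finite) (use card \<open>q ^ e \<ge> 2\<close> in linarith)
  then have "\<exists>g. g \<noteq> 0 \<and> ?L - {0} = range (\<lambda>i. g ^ i) \<and> (\<forall>i. g ^ i = 1 \<longleftrightarrow> (card ?L - 1) dvd i)"
    using \<open>q ^ e \<ge> 2\<close> \<open>q \<ge> 2\<close>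
    by (intro finite_subfield_has_generator)
       (auto simp: frobenius_add frobenius_minus power_mult_distrib power_inverse power_0_left)
  then obtain g where g: "g \<noteq> 0" "?L - {0} = range (\<lambda>i. g ^ i)"
    "\<And>i. g ^ i = 1 \<longleftrightarrow> (q ^ e - 1) dvd i"
    unfolding card by blast
  show thesis
  proof (rule that[OF g(1) _ g(3)])
    fix y :: "'a alg_closure" assume "y ^ (q ^ e) = y" "y \<noteq> 0"
    then have "y \<in> range (\<lambda>i. g ^ i)" using g(2) by blast
    then show "\<exists>i. y = g ^ i" by blast
  qed
qed

text \<open>The direct product decomposition of the nonzero elements of L, with
  \<open>\<beta> = g ^ N\<close> of order \<open>n\<close>. Existence allows \<open>z = 0\<close> so
  that it also covers \<open>y = 0\<close>; uniqueness of the exponent needs nonzero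
  \<open>z\<close>.\<close>

lemma fixed_field_decomposition:
  assumes "k > 0" and cop: "coprime (d + 1) (q ^ k - 1)" and n: "n = (\<Sum>r=0..d. q ^ (k * r))"
  obtains \<beta> :: "'a alg_closure" where
    "\<beta> ^ n = 1" "\<beta> ^ (q ^ (k * (d + 1))) = \<beta>"
    "\<And>y. y ^ (q ^ (k * (d + 1))) = y \<Longrightarrow> \<exists>r<n. \<exists>z. z ^ (q ^ k) = z \<and> y = \<beta> ^ r * z"
    "\<And>z z' r s. z ^ (q ^ k) = z \<Longrightarrow> z' ^ (q ^ k) = z' \<Longrightarrow> z \<noteq> 0 \<Longrightarrow> z' \<noteq> 0 \<Longrightarrow>
       r < n \<Longrightarrow> s < n \<Longrightarrow> \<beta> ^ r * z = \<beta> ^ s * z' \<Longrightarrow> r = s"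
proof -
  define N where "N = q ^ k - 1"
  define M where "M = q ^ (k * (d + 1)) - 1"
  have "q \<ge> 2" using pp primepow_gt_Suc_0 by fastforce
  then have qk: "q ^ k \<ge> 2"
    using assms(1) by (metis le_trans self_le_power one_le_numeral)
  then have qk_eq: "q ^ k = Suc N" by (simp add: N_def)
  have M_eq: "q ^ (k * (d + 1)) = Suc M"
    using \<open>q \<ge> 2\<close> by (simp add: M_def)
  have n': "n = (\<Sum>r=0..d. (q ^ k) ^ r)" by (simp add: n power_mult)
  have nN: "n * N = M"
    unfolding n' N_def M_def power_mult using qk by (intro sum_powers_mult_diff) simp
  have copn: "coprime n N"
    unfolding n' N_def using qk cop by (intro coprime_sum_powers) simp_all
  have "n > 0" unfolding n' by (simp add: sum.atLeast0_atMost_Suc_shift sum.atLeast_Suc_atMost)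
  have fixN: "z ^ (q ^ k) = z \<longleftrightarrow> z ^ N = 1" if "z \<noteq> 0" for z :: "'a alg_closure"
    using that by (simp add: qk_eq)
  obtain g :: "'a alg_closure" where g: "g \<noteq> 0"
    "\<And>y. y ^ (q ^ (k * (d + 1))) = y \<Longrightarrow> y \<noteq> 0 \<Longrightarrow> \<exists>i. y = g ^ i"
    "\<And>i. g ^ i = 1 \<longleftrightarrow> M dvd i"
    using fixed_field_generator[of "k * (d + 1)"] assms(1) unfolding M_def by auto
  have g_mod: "g ^ (i mod M) = g ^ i" for i
  proof -
    have "g ^ i = g ^ (M * (i div M)) * g ^ (i mod M)" by (simp flip: power_add)
    also have "g ^ (M * (i div M)) = 1" using g(3) by simp
    finally show ?thesis by simp
  qed
  define \<beta> where "\<beta> = g ^ N"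
  have "\<beta> \<noteq> 0" using g(1) by (simp add: \<beta>_def)
  have "\<beta> ^ n = 1"
    using g(3)[of M] nN by (simp add: \<beta>_def mult.commute flip: power_mult)
  moreover have "\<beta> ^ (q ^ (k * (d + 1))) = \<beta>"
    using \<open>\<beta> ^ n = 1\<close> unfolding M_eq by (simp add: power_mult flip: nN)
  moreover have "\<exists>r<n. \<exists>z. z ^ (q ^ k) = z \<and> y = \<beta> ^ r * z" if y: "y ^ (q ^ (k * (d + 1))) = y" for y
  proof (cases "y = 0")
    case True
    then show ?thesis
      using \<open>n > 0\<close> \<open>q \<ge> 2\<close> by (intro exI[of _ 0] conjI) (auto simp: power_0_left)
  next
    case False
    obtain i where i: "y = g ^ i" using g(2) y False by blast
    \<comment> \<open>\<open>y / \<beta> ^ r\<close> lies in K iff its \<open>N\<close>-th power is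
      1, that is, iff \<open>N * r\<close> is congruent to \<open>i\<close> modulo \<open>n\<close>.
      The inverse \<open>x\<close> of \<open>N\<close> modulo \<open>n\<close> provides such an
      \<open>r\<close>.\<close>
    obtain x where "[N * x = 1] (mod n)"
      using copn cong_solve_coprime_nat[of N n] by (auto simp: coprime_commute)
    define r where "r = (x * i) mod n"
    have "[N * r = N * x * i] (mod n)"
      by (simp add: r_def cong_def mod_mult_right_eq mult.assoc)
    also have "[N * x * i = 1 * i] (mod n)"
      by (intro cong_mult cong_refl) fact
    \<comment> \<open>Multiplying by \<open>N\<close> lifts the congruence from modulus
      \<open>n\<close> to \<open>n * N = M\<close>, the order of \<open>g\<close>.\<close>
    finally have "[N * r * N = i * N] (mod (n * N))"
      by (simp add: cong_def mod_mult_mult2)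
    then have "g ^ (N * r * N) = g ^ (i * N)"
      unfolding nN cong_def by (metis g_mod)
    then have "(y / \<beta> ^ r) ^ N = 1"
      using g(1) by (simp add: i \<beta>_def power_divide flip: power_mult)
    moreover have "y / \<beta> ^ r \<noteq> 0" using False \<open>\<beta> \<noteq> 0\<close> by simp
    ultimately have "(y / \<beta> ^ r) ^ (q ^ k) = y / \<beta> ^ r" using fixN by blast
    moreover have "y = \<beta> ^ r * (y / \<beta> ^ r)" using \<open>\<beta> \<noteq> 0\<close> by simp
    moreover have "r < n" using \<open>n > 0\<close> by (simp add: r_def)
    ultimately show ?thesis by blast
  qed
  moreover have "r = s"
    if z: "z ^ (q ^ k) = z" "z' ^ (q ^ k) = z'" "z \<noteq> 0" "z' \<noteq> 0"
      and "r < n" "s < n" and eq: "\<beta> ^ r * z = \<beta> ^ s * z'" for z z' r s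
  proof -
    \<comment> \<open>Otherwise \<open>n\<close> would divide \<open>b - a\<close>, which lies
      strictly between 0 and \<open>n\<close>. The one-sided form keeps the subtraction from
      truncating and is used in both directions.\<close>
    have *: "b \<le> a" if "a < n" "b < n" "\<beta> ^ (a * N) = \<beta> ^ (b * N)" for a b
    proof (rule ccontr)
      assume "\<not> b \<le> a"
      then have "\<beta> ^ (b * N) = \<beta> ^ (a * N) * \<beta> ^ ((b - a) * N)"
        by (simp add: flip: power_add add_mult_distrib)
      then have "\<beta> ^ ((b - a) * N) = 1"
        using that(3) \<open>\<beta> \<noteq> 0\<close> by simp
      then have "n * N dvd N * ((b - a) * N)"
        using g(3) by (simp add: nN \<beta>_def flip: power_mult)
      then have "n dvd N * (b - a)"
        using qk by (simp add: N_def flip: mult.assoc)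
      then have "n dvd b - a"
        using copn by (simp add: coprime_dvd_mult_right_iff)
      then have "n \<le> b - a"
        using \<open>\<not> b \<le> a\<close> by (intro dvd_imp_le) auto
      then show False using that \<open>\<not> b \<le> a\<close> by linarith
    qed
    \<comment> \<open>Taking \<open>N\<close>-th powers removes the factors from K and leaves only
      powers of \<open>\<beta>\<close>.\<close>
    have "z ^ N = 1" "z' ^ N = 1" using z fixN by blast+
    moreover have "(\<beta> ^ r * z) ^ N = (\<beta> ^ s * z') ^ N" by (simp only: eq)
    ultimately have "\<beta> ^ (r * N) = \<beta> ^ (s * N)"
      by (simp add: power_mult_distrib power_mult)
    then show "r = s"
      using *[of r s] *[of s r] \<open>r < n\<close> \<open>s < n\<close> by (simp add: le_antisym)
  qed
  ultimately show thesis by (rule that)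
qed

end

section \<open>The cyclic shift as multiplication by a root of unity\<close>

lemma cyclic_shift_closed: "x \<in> carrier_vec n \<Longrightarrow> cyclic_shift x \<in> carrier_vec n"
  by (simp add: cyclic_shift_def)

lemma bij_betw_cyclic_shift:
  "bij_betw cyclic_shift (carrier_vec n :: 'a vec set) (carrier_vec n)"
\<comment> \<open>The inverse is the shift in the opposite direction; only one index wraps
  around.\<close>
proof (rule bij_betwI[where g = "\<lambda>x. vec n (\<lambda>i. x $ ((i + 1) mod n))"])
  fix x :: "'a vec" assume x: "x \<in> carrier_vec n"
  show "vec n (\<lambda>i. cyclic_shift x $ ((i + 1) mod n)) = x"
  proof (rule eq_vecI)
    fix i assume "i < dim_vec x"
    then have i: "i < n" using x by simp
    then have "((i + 1) mod n + n - 1) mod n = i"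
      by (cases "i + 1 = n") auto
    then show "vec n (\<lambda>i. cyclic_shift x $ ((i + 1) mod n)) $ i = x $ i"
      using x i by (simp add: cyclic_shift_def)
  qed (use x in simp)
  show "cyclic_shift (vec n (\<lambda>i. x $ ((i + 1) mod n))) = x"
  proof (rule eq_vecI)
    fix i assume "i < dim_vec x"
    then have i: "i < n" using x by simp
    then have "((i + n - 1) mod n + 1) mod n = i"
      by (cases "i = 0") (auto simp: mod_Suc_eq)
    then show "cyclic_shift (vec n (\<lambda>i. x $ ((i + 1) mod n))) $ i = x $ i"
      using x i by (simp add: cyclic_shift_def)
  qed (use x in \<open>simp add: cyclic_shift_def\<close>)
qed (auto intro: cyclic_shift_closed)

lemma bij_betw_cyclic_shift_funpow:
  "bij_betw (cyclic_shift ^^ r) (carrier_vec n) (carrier_vec n)"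
  by (intro bij_betw_funpow bij_betw_cyclic_shift)

text \<open>Evaluation at \<open>\<beta>\<close> of the polynomial with coefficient vector
  \<open>x\<close>. When \<open>\<beta> ^ n = 1\<close> it factors through F_q[X]/(X^n - 1), where
  the cyclic shift is multiplication by X.\<close>

definition eval_vec :: "'a::field alg_closure \<Rightarrow> 'a vec \<Rightarrow> 'a alg_closure" where
  "eval_vec \<beta> x = (\<Sum>i<dim_vec x. to_ac (x $ i) * \<beta> ^ i)"

lemma eval_vec_zero: "eval_vec \<beta> (0\<^sub>v n) = 0"
  by (simp add: eval_vec_def)

lemma eval_vec_add:
  assumes "x \<in> carrier_vec n" "y \<in> carrier_vec n"
  shows "eval_vec \<beta> (x + y) = eval_vec \<beta> x + eval_vec \<beta> y"
  using assms by (simp add: eval_vec_def sum.distrib distrib_right)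

lemma eval_vec_smult: "eval_vec \<beta> (c \<cdot>\<^sub>v x) = to_ac c * eval_vec \<beta> x"
  by (simp add: eval_vec_def sum_distrib_left mult.assoc)

lemma eval_vec_unit_vec_0: "n > 0 \<Longrightarrow> eval_vec \<beta> (unit_vec n 0) = 1"
  by (cases n) (simp_all add: eval_vec_def unit_vec_def sum.lessThan_Suc_shift del: sum.lessThan_Suc)

text \<open>Each coefficient moves up by one power of \<open>\<beta>\<close>; the last one wraps
  around to power 0, which is consistent because \<open>\<beta> * \<beta> ^ m = 1\<close>.\<close>

lemma eval_vec_cyclic_shift:
  assumes "\<beta> ^ dim_vec x = 1"
  shows "eval_vec \<beta> (cyclic_shift x) = \<beta> * eval_vec \<beta> x"
proof (cases "dim_vec x")
  case 0
  then show ?thesis by (simp add: eval_vec_def cyclic_shift_def)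
next
  case (Suc m)
  have \<beta>: "\<beta> * \<beta> ^ m = 1" using assms Suc by simp
  have "eval_vec \<beta> (cyclic_shift x) = (\<Sum>i<Suc m. to_ac (x $ ((i + m) mod Suc m)) * \<beta> ^ i)"
    by (simp add: eval_vec_def cyclic_shift_def Suc del: sum.lessThan_Suc)
  also have "\<dots> = to_ac (x $ m) + (\<Sum>i<m. to_ac (x $ ((Suc i + m) mod Suc m)) * \<beta> ^ Suc i)"
    by (subst sum.lessThan_Suc_shift) simp
  also have "(\<Sum>i<m. to_ac (x $ ((Suc i + m) mod Suc m)) * \<beta> ^ Suc i) =
      (\<Sum>i<m. \<beta> * (to_ac (x $ i) * \<beta> ^ i))"
  proof (rule sum.cong)
    fix i assume "i \<in> {..<m}"
    then have "(Suc i + m) mod Suc m = i"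
      unfolding add_Suc_shift mod_add_self2 by simp
    then show "to_ac (x $ ((Suc i + m) mod Suc m)) * \<beta> ^ Suc i = \<beta> * (to_ac (x $ i) * \<beta> ^ i)"
      by (simp add: mult_ac)
  qed simp
  also have "to_ac (x $ m) + \<dots> = \<beta> * eval_vec \<beta> x"
    using \<beta> by (simp add: eval_vec_def Suc sum_distrib_left distrib_left mult.left_commute)
  finally show ?thesis .
qed

lemma eval_vec_cyclic_shift_funpow:
  assumes "\<beta> ^ n = 1" and "x \<in> carrier_vec n"
  shows "eval_vec \<beta> ((cyclic_shift ^^ r) x) = \<beta> ^ r * eval_vec \<beta> x"
proof (induction r)
  case (Suc r)
  have "(cyclic_shift ^^ r) x \<in> carrier_vec n"
    using bij_betw_cyclic_shift_funpow assms(2) by (rule bij_betw_apply)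
  then have "dim_vec ((cyclic_shift ^^ r) x) = n" by simp
  then show ?case
    using Suc assms(1) by (simp add: eval_vec_cyclic_shift mult.assoc)
qed simp

section \<open>Counting in cyclically covering subspaces\<close>

text \<open>Coordinates with respect to a basis identify the vectors with the functions from the
  basis to the scalars.\<close>

lemma (in vectorspace) card_carrier_eq_power_dim:
  assumes "finite (carrier V)"
  shows "card (carrier V) = card (carrier K) ^ dim"
proof -
  have "gen_set (carrier V)"
    using in_own_span[of "carrier V"] span_closed[of "carrier V"] by auto
  then have "fin_dim"
    unfolding fin_dim_def using assms by blast
  then obtain B where B: "finite B" "basis B"
    using finite_basis_exists by blast
  have BV: "B \<subseteq> carrier V" using B(2) by (simp add: basis_def)
  have "bij_betw (\<lambda>a. lincomb a B) (B \<rightarrow>\<^sub>E carrier K) (carrier V)"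
  proof (rule bij_betwI')
    fix a b assume a: "a \<in> B \<rightarrow>\<^sub>E carrier K" and b: "b \<in> B \<rightarrow>\<^sub>E carrier K"
    have "lincomb a B \<in> carrier V"
      using a BV by (intro lincomb_closed) auto
    then show "lincomb a B = lincomb b B \<longleftrightarrow> a = b"
      using basis_criterion[OF B(1) BV] B(2) a b by metis
  next
    fix a assume "a \<in> B \<rightarrow>\<^sub>E carrier K"
    then show "lincomb a B \<in> carrier V"
      using BV by (intro lincomb_closed) auto
  next
    fix v assume "v \<in> carrier V"
    then show "\<exists>a\<in>B \<rightarrow>\<^sub>E carrier K. v = lincomb a B"
      using basis_criterion[OF B(1) BV] B(2) by metis
  qed
  then have "card (carrier V) = card (B \<rightarrow>\<^sub>E carrier K)"
    by (simp add: bij_betw_same_card)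
  also have "\<dots> = card (carrier K) ^ dim"
    using B by (simp add: card_PiE dim_basis)
  finally show ?thesis .
qed

lemma finite_carrier_vec: "finite (carrier_vec n :: 'a::finite vec set)"
proof (rule finite_subset)
  show "carrier_vec n \<subseteq> vec_of_list ` {xs :: 'a list. set xs \<subseteq> UNIV \<and> length xs = n}"
  proof
    fix x :: "'a vec" assume "x \<in> carrier_vec n"
    then show "x \<in> vec_of_list ` {xs. set xs \<subseteq> UNIV \<and> length xs = n}"
      by (intro image_eqI[of _ _ "list_of_vec x"]) (simp_all add: vec_list)
  qed
qed (rule finite_imageI[OF finite_lists_length_eq[OF finite]])

lemma subspace_module_vecI:
  fixes U :: "'a::field vec set"
  assumes "U \<subseteq> carrier_vec n" and "0\<^sub>v n \<in> U"
    and "\<And>x y. x \<in> U \<Longrightarrow> y \<in> U \<Longrightarrow> x + y \<in> U"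
    and "\<And>c x. x \<in> U \<Longrightarrow> c \<cdot>\<^sub>v x \<in> U"
  shows "VectorSpace.subspace class_ring U (module_vec TYPE('a) n)"
  unfolding VectorSpace.subspace_def
  using vec_vs vec_module assms
  by (auto intro!: submodule.intro simp: module_vec_simps)

lemma card_carrier_vec:
  "card (carrier_vec n :: 'a::{field,finite} vec set) = card (UNIV :: 'a set) ^ n"
proof -
  interpret vec_space "TYPE('a)" n .
  show ?thesis
    using card_carrier_eq_power_dim finite_carrier_vec[of n, where ?'a = 'a] dim_is_n by simp
qed

lemma card_mult_power_codimension:
  fixes U :: "'a::{field,finite} vec set"
  assumes "VectorSpace.subspace class_ring U (module_vec TYPE('a) n)"
  shows "card U * card (UNIV :: 'a set) ^ codimension n U = card (UNIV :: 'a set) ^ n"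
proof -
  let ?q = "card (UNIV :: 'a set)"
  interpret vec_space "TYPE('a)" n .
  interpret U: vectorspace class_ring "V\<lparr>carrier := U\<rparr>"
    using assms by (rule subspace_is_vs)
  have U: "U \<subseteq> carrier_vec n"
    using assms by (auto simp: VectorSpace.subspace_def submodule_def)
  then have "finite U"
    using finite_carrier_vec finite_subset by blast
  then have cardU: "card U = ?q ^ U.dim"
    using U.card_carrier_eq_power_dim by simp
  have "card {0, 1 :: 'a} \<le> ?q"
    by (rule card_mono) simp_all
  then have "?q > 1" by simp
  have "?q ^ U.dim \<le> ?q ^ n"
    using card_mono[OF finite_carrier_vec U] by (simp add: cardU card_carrier_vec)
  \<comment> \<open>This keeps the subtraction in \<open>codimension\<close> from
    truncating.\<close>
  then have "U.dim \<le> n"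
    using \<open>?q > 1\<close> power_le_imp_le_exp by blast
  then show ?thesis
    by (simp add: codimension_def dim_is_n cardU flip: power_add)
qed

lemma power_codimension_le:
  fixes U :: "'a::{field,finite} vec set"
  assumes "cyclically_covering n U"
  shows "card (UNIV :: 'a set) ^ codimension n U \<le> n"
proof -
  let ?q = "card (UNIV :: 'a set)"
  from assms have U: "VectorSpace.subspace class_ring U (module_vec TYPE('a) n)"
    and cov: "(\<Union>r\<in>{0..<n}. (cyclic_shift ^^ r) ` U) = carrier_vec n"
    by (simp_all add: cyclically_covering_def)
  have "finite U"
    using U finite_carrier_vec finite_subset[of U "carrier_vec n"]
    by (auto simp: VectorSpace.subspace_def submodule_def module_vec_simps)
  have "card U * ?q ^ codimension n U = card (\<Union>r\<in>{0..<n}. (cyclic_shift ^^ r) ` U)"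
    unfolding cov by (simp add: card_carrier_vec card_mult_power_codimension[OF U])
  also have "\<dots> \<le> (\<Sum>r\<in>{0..<n}. card ((cyclic_shift ^^ r) ` U))"
    by (rule card_UN_le) simp
  also have "\<dots> \<le> (\<Sum>r\<in>{0..<n}. card U)"
    by (intro sum_mono card_image_le \<open>finite U\<close>)
  finally have "card U * ?q ^ codimension n U \<le> card U * n"
    by (simp add: mult.commute)
  moreover have "card U > 0"
    using card_mult_power_codimension[OF U] by (intro Nat.gr0I) simp
  ultimately show ?thesis by simp
qed

lemma cyclically_covering_carrier:
  assumes "n > 0"
  shows "cyclically_covering n (carrier_vec n :: 'a::field vec set)"
  unfolding cyclically_covering_def
proof
  show "VectorSpace.subspace class_ring (carrier_vec n) (module_vec TYPE('a) n)"
    by (rule subspace_module_vecI) auto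
  show "(\<Union>r\<in>{0..<n}. (cyclic_shift ^^ r) ` carrier_vec n) = carrier_vec n"
    using assms bij_betw_imp_surj_on[OF bij_betw_cyclic_shift_funpow] by auto
qed

text \<open>For \<open>a = q ^ k\<close> the sum is \<open>n\<close>. The factor 2 is harmless: it
  is at most \<open>q\<close>, so it costs less than a full step in the exponent.\<close>

lemma geometric_sum_lt:
  fixes a :: nat
  assumes "a \<ge> 2"
  shows "(\<Sum>r=0..d. a ^ r) < 2 * a ^ d"
proof (induction d)
  case (Suc d)
  have "2 * a ^ d \<le> a * a ^ d" using assms by simp
  with Suc show ?case
    by (simp only: sum.atLeast0_atMost_Suc power_Suc)
qed simp

text \<open>The codimension is bounded by counting the disjoint shifts of \<open>U - W\<close>, so
  the image of the evaluation need not be determined; the factor 2 is the price of removing the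
  kernel \<open>W\<close>.\<close>

lemma ex_cyclically_covering:
  fixes q k d n :: nat
  assumes q: "q = card (UNIV :: 'a::{field,finite} set)" and pp: "primepow q" and "k > 0"
    and cop: "coprime (d + 1) (q ^ k - 1)" and n: "n = (\<Sum>r=0..d. q ^ (k * r))"
  shows "\<exists>U :: 'a vec set. cyclically_covering n U \<and> n \<le> 2 * q ^ codimension n U"
proof -
  note frob = frobenius_add[OF q pp] frobenius_to_ac[OF q pp] frobenius_sum[OF q pp]
  obtain \<beta> :: "'a alg_closure" where \<beta>: "\<beta> ^ n = 1" "\<beta> ^ (q ^ (k * (d + 1))) = \<beta>"
    and decomp: "\<And>y. y ^ (q ^ (k * (d + 1))) = y \<Longrightarrow> \<exists>r<n. \<exists>z. z ^ (q ^ k) = z \<and> y = \<beta> ^ r * z"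
    and unique: "\<And>z z' r s. z ^ (q ^ k) = z \<Longrightarrow> z' ^ (q ^ k) = z' \<Longrightarrow> z \<noteq> 0 \<Longrightarrow> z' \<noteq> 0 \<Longrightarrow>
       r < n \<Longrightarrow> s < n \<Longrightarrow> \<beta> ^ r * z = \<beta> ^ s * z' \<Longrightarrow> r = s"
    using fixed_field_decomposition[OF q pp \<open>k > 0\<close> cop n] by blast
  have "q > 0" using pp primepow_gt_0_nat by blast
  then have "n > 0"
    by (simp add: n sum.atLeast_Suc_atMost)
  have "\<beta> \<noteq> 0" using \<beta>(1) \<open>n > 0\<close> by (auto simp: power_0_left)
  let ?V = "carrier_vec n :: 'a vec set"
  let ?ev = "eval_vec \<beta>"
  define U where "U = {x \<in> ?V. ?ev x ^ (q ^ k) = ?ev x}"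
  define W where "W = {x \<in> ?V. ?ev x = 0}"
  have [simp]: "finite U" "finite W"
    using finite_carrier_vec[of n, where ?'a = 'a] by (simp_all add: U_def W_def)
  have "W \<subseteq> U"
    using \<open>q > 0\<close> by (auto simp: U_def W_def power_0_left)
  have ev_shift: "?ev ((cyclic_shift ^^ r) x) = \<beta> ^ r * ?ev x" if "x \<in> ?V" for x r
    using eval_vec_cyclic_shift_funpow[OF \<beta>(1) that] .
  have sub: "VectorSpace.subspace class_ring U (module_vec TYPE('a) n)"
    using \<open>q > 0\<close>
    by (intro subspace_module_vecI)
       (auto simp: U_def eval_vec_zero eval_vec_add eval_vec_smult frob power_mult_distrib power_0_left)
  \<comment> \<open>Frobenius fixes the coefficients and \<open>\<beta>\<close>, so all values of
    the evaluation lie in L and \<open>decomp\<close> applies to them.\<close>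
  have fixed_ev: "?ev x ^ (q ^ (k * (d + 1))) = ?ev x" for x
  proof -
    have "(\<beta> ^ i) ^ (q ^ (k * (d + 1))) = \<beta> ^ i" for i
      using \<beta>(2) by (metis power_mult mult.commute)
    then show ?thesis
      by (simp only: eval_vec_def frob power_mult_distrib)
  qed
  have "?V \<subseteq> (\<Union>r\<in>{0..<n}. (cyclic_shift ^^ r) ` U)"
  proof
    fix x assume x: "x \<in> ?V"
    obtain r z where r: "r < n" "z ^ (q ^ k) = z" "?ev x = \<beta> ^ r * z"
      using decomp[OF fixed_ev] by blast
    \<comment> \<open>Undoing \<open>r\<close> shifts divides the value by
      \<open>\<beta> ^ r\<close> and leaves \<open>z\<close>, an element of K.\<close>
    obtain u where u: "u \<in> ?V" "x = (cyclic_shift ^^ r) u"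
      using x bij_betw_imp_surj_on[OF bij_betw_cyclic_shift_funpow] by blast
    have "?ev u = z"
      using ev_shift[OF u(1), of r] r(3) u(2) \<open>\<beta> \<noteq> 0\<close> by simp
    then have "u \<in> U"
      using u(1) r(2) by (simp add: U_def)
    with u(2) r(1) show "x \<in> (\<Union>r\<in>{0..<n}. (cyclic_shift ^^ r) ` U)" by auto
  qed
  moreover have shift_in: "(cyclic_shift ^^ r) x \<in> ?V" if "x \<in> ?V" for x r
    using bij_betw_cyclic_shift_funpow that by (rule bij_betw_apply)
  ultimately have cov: "cyclically_covering n U"
    using sub by (auto simp: cyclically_covering_def U_def)
  \<comment> \<open>Outside \<open>W\<close> the values are nonzero elements of K, so a common
    vector of two shifts would give two exponents of \<open>\<beta>\<close> for the same
    value.\<close>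
  have disj: "disjoint_family_on (\<lambda>r. (cyclic_shift ^^ r) ` (U - W)) {0..<n}"
    unfolding disjoint_family_on_def
  proof (intro ballI impI equals0I)
    fix r s y assume rs: "r \<in> {0..<n}" "s \<in> {0..<n}" "r \<noteq> s"
      and "y \<in> (cyclic_shift ^^ r) ` (U - W) \<inter> (cyclic_shift ^^ s) ` (U - W)"
    then obtain x x' where x: "x \<in> U - W" "x' \<in> U - W"
      and eq: "(cyclic_shift ^^ r) x = (cyclic_shift ^^ s) x'" by auto
    have "\<beta> ^ r * ?ev x = \<beta> ^ s * ?ev x'"
      using ev_shift[of x r] ev_shift[of x' s] eq x by (simp add: U_def)
    then have "r = s"
      by (intro unique[of "?ev x" "?ev x'"]) (use x rs in \<open>auto simp: U_def W_def\<close>)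
    with rs show False by simp
  qed
  have "n * card (U - W) = (\<Sum>r\<in>{0..<n}. card ((cyclic_shift ^^ r) ` (U - W)))"
  proof -
    have "card ((cyclic_shift ^^ r) ` (U - W)) = card (U - W)" for r
      using bij_betw_imp_inj_on[OF bij_betw_cyclic_shift_funpow]
      by (intro card_image) (auto simp: U_def intro: inj_on_subset)
    then show ?thesis by simp
  qed
  also have "\<dots> = card (\<Union>r\<in>{0..<n}. (cyclic_shift ^^ r) ` (U - W))"
    using disj by (intro card_UN_disjoint[symmetric]) (auto simp: disjoint_family_on_def)
  also have "\<dots> \<le> card ?V"
    by (intro card_mono finite_carrier_vec) (use shift_in in \<open>auto simp: U_def\<close>)
  finally have le: "n * card (U - W) \<le> q ^ n"
    by (simp add: card_carrier_vec q)
  \<comment> \<open>The first unit vector has value 1, so translating by it turns value 0 into value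
    1 and injects \<open>W\<close> into \<open>U - W\<close>.\<close>
  have "card W \<le> card (U - W)"
  proof (rule card_inj_on_le)
    show "inj_on (\<lambda>x. x + unit_vec n 0) W"
    proof (rule inj_onI)
      fix x y assume "x \<in> W" "y \<in> W" and eq: "x + unit_vec n 0 = y + unit_vec n 0"
      then have "x \<in> ?V" "y \<in> ?V" by (simp_all add: W_def)
      show "x = y"
      proof (rule eq_vecI)
        fix i assume "i < dim_vec y"
        then have "x $ i + unit_vec n 0 $ i = y $ i + unit_vec n 0 $ i"
          using arg_cong[OF eq, of "\<lambda>v. v $ i"] \<open>y \<in> ?V\<close> by simp
        then show "x $ i = y $ i" by simp
      qed (use \<open>x \<in> ?V\<close> \<open>y \<in> ?V\<close> in simp)
    qed
    show "(\<lambda>x. x + unit_vec n 0) ` W \<subseteq> U - W"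
      using \<open>n > 0\<close>
      by (auto simp: W_def U_def eval_vec_add[where n = n] eval_vec_unit_vec_0)
  qed simp
  moreover have "card (U - W) = card U - card W" "card W \<le> card U"
    using \<open>W \<subseteq> U\<close> by (simp_all add: card_Diff_subset card_mono)
  ultimately have "card U \<le> 2 * card (U - W)" by linarith
  then have "card U * n \<le> 2 * (n * card (U - W))"
    by (metis mult.commute mult.left_commute mult_le_mono2)
  also have "\<dots> \<le> 2 * q ^ n" using le by simp
  also have "\<dots> = card U * (2 * q ^ codimension n U)"
    using card_mult_power_codimension[OF sub] by (simp add: q)
  finally have "card U * n \<le> card U * (2 * q ^ codimension n U)" .
  moreover have "card U > 0"
    using card_mult_power_codimension[OF sub] \<open>q > 0\<close> by (intro Nat.gr0I) (simp add: q)
  ultimately have "n \<le> 2 * q ^ codimension n U" by simp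
  with cov show ?thesis by blast
qed

theorem theorem3p4:
  fixes q k d n :: nat
  assumes "primepow q"
    and "card (UNIV :: 'a::{field,finite} set) = q"
    and "gcd (d + 1) (q ^ k - 1) = 1"
    and "n = (\<Sum>r=0..d. q ^ (k * r))"
  shows "max_covering_codim TYPE('a) n = k * d"
proof -
  have "q \<ge> 2" using assms(1) primepow_gt_Suc_0 by fastforce
  have "n > 0"
    using \<open>q \<ge> 2\<close> by (simp add: assms(4) sum.atLeast_Suc_atMost)
  \<comment> \<open>For \<open>k = 0\<close> the gcd would be
    \<open>gcd (d + 1) 0 = d + 1 > 1\<close>. If \<open>d = 0\<close>, then \<open>k = 0\<close> is
    possible, which is why that case is split off below.\<close>
  have k: "k > 0" if "d > 0"
    using that assms(3) by (intro Nat.gr0I) simp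
  have n_less: "n < 2 * q ^ (k * d)"
  proof (cases "d = 0")
    case True
    then show ?thesis by (simp add: assms(4))
  next
    case False
    then have "q ^ 1 \<le> q ^ k"
      using k \<open>q \<ge> 2\<close> by (intro power_increasing) auto
    then show ?thesis
      using geometric_sum_lt[of "q ^ k" d] \<open>q \<ge> 2\<close> by (simp add: assms(4) power_mult)
  qed
  have upper: "codimension n U \<le> k * d" if "cyclically_covering n U" for U :: "'a vec set"
  proof -
    have "q ^ codimension n U < 2 * q ^ (k * d)"
      using power_codimension_le[OF that] n_less by (simp add: assms(2))
    \<comment> \<open>Absorbing 2 into one more factor \<open>q\<close> keeps the inequality strict,
      which gives the exact bound on the exponent.\<close>
    also have "\<dots> \<le> q ^ Suc (k * d)" using \<open>q \<ge> 2\<close> by simp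
    finally have "codimension n U < Suc (k * d)"
      by (rule power_less_imp_less_exp[rotated]) (use \<open>q \<ge> 2\<close> in simp)
    then show ?thesis by simp
  qed
  have "\<exists>U :: 'a vec set. cyclically_covering n U \<and> k * d \<le> codimension n U"
  proof (cases "d = 0")
    case True
    then show ?thesis using cyclically_covering_carrier \<open>n > 0\<close> by auto
  next
    case False
    have "coprime (d + 1) (q ^ k - 1)"
      using assms(3) by (simp only: coprime_iff_gcd_eq_1)
    then obtain U :: "'a vec set" where U: "cyclically_covering n U" "n \<le> 2 * q ^ codimension n U"
      using ex_cyclically_covering[OF assms(2)[symmetric] assms(1)] k assms(4) False by blast
    \<comment> \<open>The summands for \<open>r = 0\<close> and \<open>r = d\<close> are distinct as
      \<open>d > 0\<close> and already add up to \<open>1 + q ^ (k * d)\<close>.\<close>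
    have "q ^ (k * d) < (\<Sum>r\<in>{0, d}. q ^ (k * r))"
      using False by simp
    also have "\<dots> \<le> n"
      unfolding assms(4) by (rule sum_mono2) auto
    also note U(2)
    also have "2 * q ^ codimension n U \<le> q ^ Suc (codimension n U)"
      using \<open>q \<ge> 2\<close> by simp
    finally have "k * d < Suc (codimension n U)"
      by (rule power_less_imp_less_exp[rotated]) (use \<open>q \<ge> 2\<close> in simp)
    with U(1) show ?thesis by auto
  qed
  then obtain U :: "'a vec set" where U: "cyclically_covering n U" "codimension n U = k * d"
    using upper le_antisym by blast
  show ?thesis
    unfolding max_covering_codim_def
  proof (rule Max_eqI)
    show "finite {codimension n U |U :: 'a vec set. cyclically_covering n U}"
      by (rule finite_subset[of _ "{..k * d}"]) (use upper in auto)
    show "k * d \<in> {codimension n U |U :: 'a vec set. cyclically_covering n U}"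
      using U by (auto intro: exI[of _ U])
  qed (use upper in auto)
qed

end
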